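(* Let $X \subset \mathbb{R}^n$ be a Delone set with covering radius $R$. If there is a single value of $T > 0$ such that $$N_X(T) < \frac{T}{2R},$$ then $X$ is an ideal crystal.
   Context: A Delone set in $\mathbb{R}^n$ is a discrete set $X \subset \mathbb{R}^n$ that is uniformly discrete (its packing radius $r$ by equal balls, i.e. half the infimum of the distances between distinct points of $X$, is positive) and relatively dense (its covering radius $R$, i.e. the smallest radius such that the closed balls of that radius centered at points of $X$ cover $\mathbb{R}^n$, is finite). For $\mathbf{x}\in X$ and $T>0$, the $T$-patch of $X$ centered at $\mathbf{x}$ is $\mathcal{P}_X(\mathbf{x};T) = X\cap B(\mathbf{x};T)$, where $B(\mathbf{x};T)$ is the open ball with center $\mathbf{x}$ and radius $T$. Two patches are translation-equivalent, $\mathcal{P}_X(\mathbf{x};T)\sim\mathcal{P}_X(\mathbf{y};T)$, if $\mathcal{P}_X(\mathbf{y};T)=\mathcal{P}_X(\mathbf{x};T)+\mathbf{y}-\mathbf{x}$. The patch-counting function $N_X(T)$ is the number (possibly infinite) of translation-inequivalent $T$-patches centered at points of $X$. A Delone set $X$ in $\mathbb{R}^n$ is an ideal crystal if it has a full rank lattice of translation symmetries, i.e. $X=\Lambda+F$ where $\Lambda$ is a full rank lattice in $\mathbb{R}^n$ and $F$ is a finite set. *)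

theory Defs
  imports "HOL-Analysis.Analysis" "HOL-Library.Set_Algebras"
begin

text \<open>Both radii are extended reals, so that an infimum over the empty set is \<open>\<infinity>\<close>.\<close>

definition packing_radius :: "(real ^ 'n) set \<Rightarrow> ereal" where
  "packing_radius X = Inf {ereal (dist x y) | x y. x \<in> X \<and> y \<in> X \<and> x \<noteq> y} / 2"

text \<open>When \<open>X\<close> is uniformly discrete and this infimum is finite, it is attained:
  it is then the smallest radius for which the closed balls cover the space.\<close>

definition covering_radius :: "(real ^ 'n) set \<Rightarrow> ereal" where
  "covering_radius X = Inf {ereal r | r. (\<Union>x\<in>X. cball x r) = UNIV}"

definition delone_set :: "(real ^ 'n) set \<Rightarrow> bool" where
  "delone_set X \<longleftrightarrow> discrete X \<and> packing_radius X > 0 \<and> covering_radius X < \<infinity>"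

definition patch :: "(real ^ 'n) set \<Rightarrow> real ^ 'n \<Rightarrow> real \<Rightarrow> (real ^ 'n) set" where
  "patch X x T = X \<inter> ball x T"

text \<open>A patch carries its center, so translation-equivalence is a relation on centers.
  (Two centers may have the same set as patch and still be inequivalent.)\<close>

definition patch_equiv :: "(real ^ 'n) set \<Rightarrow> real \<Rightarrow> ((real ^ 'n) \<times> (real ^ 'n)) set" where
  "patch_equiv X T =
     {(x, y). x \<in> X \<and> y \<in> X \<and> patch X y T = (\<lambda>z. z + y - x) ` patch X x T}"

definition patch_count :: "(real ^ 'n) set \<Rightarrow> real \<Rightarrow> enat" where
  "patch_count X T =
     (if finite (X // patch_equiv X T) then enat (card (X // patch_equiv X T)) else \<infinity>)"

lemma equiv_patch_equiv: "equiv X (patch_equiv X T)"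
proof (rule equivI)
  show "patch_equiv X T \<subseteq> X \<times> X"
    by (auto simp: patch_equiv_def)
  show "refl_on X (patch_equiv X T)"
    by (auto simp: refl_on_def patch_equiv_def)
  show "sym (patch_equiv X T)"
    by (auto simp: sym_def patch_equiv_def image_image)
  show "trans (patch_equiv X T)"
    by (auto simp: trans_def patch_equiv_def image_image)
qed

definition full_rank_lattice :: "(real ^ 'n) set \<Rightarrow> bool" where
  "full_rank_lattice L \<longleftrightarrow>
     (\<exists>B. independent B \<and> span B = UNIV \<and>
          L = {\<Sum>b\<in>B. of_int (c b) *\<^sub>R b | c :: real ^ 'n \<Rightarrow> int. True})"

definition ideal_crystal :: "(real ^ 'n) set \<Rightarrow> bool" where
  "ideal_crystal X \<longleftrightarrow>
     delone_set X \<and> (\<exists>L F. full_rank_lattice L \<and> finite F \<and> X = L + F)"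

end

theory Submission
  imports Defs
begin

text \<open>
  Write \<open>N(t)\<close> for the number of classes of \<open>t\<close>-patches. Enlarging \<open>t\<close> refines the equivalence,
  so \<open>N\<close> is nondecreasing, and it is at least \<open>1\<close>. Choose \<open>r > R\<close> so close to \<open>R\<close> that still
  \<open>N(T) < T / (2 r)\<close>. The values \<open>T, T - 2 r, T - 4 r, \<dots>\<close> that remain positive are more than
  \<open>N(T)\<close> in number, so \<open>N\<close> cannot drop at every step: there is \<open>s > 0\<close> with
  \<open>N(s) = N(s + 2 r)\<close>, and these numbers being finite, the \<open>s\<close>-patch of a center determines its
  \<open>(s + 2 r)\<close>-patch (\<open>patch_equiv_stabilizes\<close>).

  Let \<open>x\<close> and \<open>y\<close> have equivalent \<open>s\<close>-patches. Then their \<open>(s + 2 r)\<close>-patches agree, and these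
  contain the \<open>s\<close>-patches of all points of \<open>X\<close> at distance less than \<open>2 r\<close>; so each such neighbour
  \<open>z\<close> of \<open>x\<close> is equivalent to \<open>z + (y - x)\<close>. Since the balls of radius \<open>r\<close> cover the connected
  space, all of \<open>X\<close> is reached from \<open>x\<close> by such steps, and \<open>y - x\<close> is a translation symmetry of
  \<open>X\<close> (\<open>patch_equiv_imp_translation_symmetry\<close>).

  Hence \<open>X\<close> consists of finitely many orbits under its translation symmetries. As \<open>X\<close> is relatively
  dense, the symmetries span the space (\<open>translation_symmetries_span\<close>). For any linear basis of
  symmetries, the lattice \<open>L\<close> that it generates gives the crystal structure: every point of \<open>X\<close> can be moved by \<open>L\<close> into a bounded region, which
  contains only finitely many points of \<open>X\<close> (\<open>ideal_crystal_if_symmetries_span\<close>).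
\<close>

section \<open>Patch classes that stop splitting\<close>

text \<open>The map sending a \<open>P\<close>-class to the \<open>Q\<close>-class around it is onto; between finite sets of equal
  size it is then injective, so no \<open>Q\<close>-class splits.\<close>

lemma refinement_eq_if_card_le:
  assumes P: "equiv A P" and Q: "equiv A Q" and PQ: "P \<subseteq> Q"
    and fin: "finite (A // P)" and le: "card (A // P) \<le> card (A // Q)"
  shows "P = Q"
proof
  have im: "(\<lambda>C. Q `` C) ` (A // P) = A // Q"
    unfolding quotient_def using refines_equiv_class_eq2[OF PQ P Q] by (auto simp: image_UN)
  then have "card ((\<lambda>C. Q `` C) ` (A // P)) = card (A // P)"
    using le card_image_le[OF fin, of "\<lambda>C. Q `` C"] by simp
  then have inj: "inj_on (\<lambda>C. Q `` C) (A // P)"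
    using eq_card_imp_inj_on[OF fin] by blast
  show "Q \<subseteq> P"
  proof (rule subrelI)
    fix x y assume xy: "(x, y) \<in> Q"
    then have A: "x \<in> A" "y \<in> A" using equiv_type[OF Q] by auto
    have "Q `` (P `` {x}) = Q `` (P `` {y})"
      using refines_equiv_class_eq2[OF PQ P Q] equiv_class_eq[OF Q xy] by simp
    then have "P `` {x} = P `` {y}"
      using inj A by (blast dest: inj_onD intro: quotientI)
    then show "(x, y) \<in> P" using eq_equiv_class[OF _ P A(2)] by blast
  qed
qed (rule PQ)

text \<open>Moving both centers to the origin makes monotonicity in the radius evident and allows the
  equivalence to be evaluated at single displacements.\<close>

lemma patch_equiv_iff:
  "(x, y) \<in> patch_equiv X T \<longleftrightarrow>
     x \<in> X \<and> y \<in> X \<and> (\<forall>v. norm v < T \<longrightarrow> (x + v \<in> X \<longleftrightarrow> y + v \<in> X))"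
proof -
  have p: "patch X y T = (\<lambda>v. y + v) ` {v. norm v < T \<and> y + v \<in> X}" for y
  proof -
    have "z \<in> (\<lambda>v. y + v) ` {v. norm v < T \<and> y + v \<in> X}" if "z \<in> patch X y T" for z
      by (rule image_eqI[of _ _ "z - y"]) (use that in \<open>auto simp: patch_def dist_norm norm_minus_commute\<close>)
    then show ?thesis by (auto simp: patch_def dist_norm)
  qed
  have q: "(\<lambda>z. z + y - x) ` patch X x T = (\<lambda>v. y + v) ` {v. norm v < T \<and> x + v \<in> X}"
    unfolding p[of x] image_image by (simp add: algebra_simps)
  have "patch X y T = (\<lambda>z. z + y - x) ` patch X x T \<longleftrightarrow>
     {v. norm v < T \<and> y + v \<in> X} = {v. norm v < T \<and> x + v \<in> X}"
    unfolding q p[of y] by (rule inj_image_eq_iff) simp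
  then show ?thesis unfolding patch_equiv_def by auto
qed

lemma patch_equiv_antimono: "s \<le> t \<Longrightarrow> patch_equiv X t \<subseteq> patch_equiv X s"
  by (auto simp: patch_equiv_iff)

text \<open>The pigeonhole step, by induction on a bound \<open>k\<close> for the number of classes: shrinking the radius
  by \<open>2 r\<close> either leaves the classes unchanged or lowers the bound, and the hypothesis
  \<open>2 r k < T\<close> keeps the radius positive until the bound would reach \<open>0\<close>.\<close>

lemma patch_equiv_stabilizes:
  fixes X :: "(real ^ 'n) set"
  assumes "X \<noteq> {}" "r > 0" "finite (X // patch_equiv X T)"
    "card (X // patch_equiv X T) \<le> k" "2 * r * k < T"
  shows "\<exists>s>0. finite (X // patch_equiv X s) \<and> patch_equiv X s = patch_equiv X (s + 2 * r)"
  using assms(3-)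
proof (induction k arbitrary: T)
  case 0
  then show ?case using assms(1) by (auto simp: quotient_def)
next
  case (Suc k)
  define s where "s = T - 2 * r"
  have s: "2 * r * k < s" using Suc.prems(3) by (simp add: s_def algebra_simps)
  moreover have "0 \<le> 2 * r * k" using \<open>r > 0\<close> by simp
  ultimately have "0 < s" by linarith
  have sub: "patch_equiv X T \<subseteq> patch_equiv X s"
    using patch_equiv_antimono[of s T X] \<open>r > 0\<close> by (simp add: s_def)
  have fin: "finite (X // patch_equiv X s)"
    by (rule finite_refines_finite[OF Suc.prems(1) sub equiv_patch_equiv equiv_patch_equiv])
  show ?case
  proof (cases "card (X // patch_equiv X s) \<le> k")
    case True
    then show ?thesis using Suc.IH[OF fin _ s] by blast
  next
    case False
    then have "patch_equiv X T = patch_equiv X s"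
      using Suc.prems(2)
      by (intro refinement_eq_if_card_le[OF equiv_patch_equiv equiv_patch_equiv sub Suc.prems(1)]) simp
    then show ?thesis using \<open>0 < s\<close> fin by (intro exI[of _ s]) (simp add: s_def)
  qed
qed

section \<open>Equivalent patches give translation symmetries\<close>

text \<open>Otherwise the balls around \<open>C\<close> and those around the rest of \<open>X\<close> would be two nonempty disjoint
  open sets covering a connected space: balls of radius \<open>r\<close> that meet have centers less than \<open>2 r\<close>
  apart.\<close>

lemma covered_set_chain_connected:
  fixes X :: "'a :: real_normed_vector set"
  assumes cover: "(\<Union>x\<in>X. ball x r) = UNIV" and C: "C \<subseteq> X" "C \<noteq> {}"
    and step: "\<And>x y. x \<in> C \<Longrightarrow> y \<in> X \<Longrightarrow> dist x y < 2 * r \<Longrightarrow> y \<in> C"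
  shows "C = X"
proof (rule ccontr)
  assume "C \<noteq> X"
  then obtain b where b: "b \<in> X - C" using C by blast
  obtain a where a: "a \<in> C" using C by blast
  let ?U = "\<Union>x\<in>C. ball x r" and ?V = "\<Union>x\<in>X - C. ball x r"
  have "r > 0"
  proof -
    obtain x where "a \<in> ball x r" using cover by blast
    then show ?thesis using zero_le_dist[of x a] by (simp del: zero_le_dist)
  qed
  have "?U \<inter> ?V = {}"
  proof -
    have False if "x \<in> C" "y \<in> X - C" "dist x z < r" "dist y z < r" for x y z
      using that step[of x y] dist_triangle2[of x y z] by force
    then show ?thesis by fastforce
  qed
  moreover have "?U \<union> ?V = UNIV" using cover C by blast
  moreover have "open ?U" "open ?V" by auto
  moreover have "a \<in> ?U" "b \<in> ?V" using \<open>r > 0\<close> by (intro UN_I[OF a] UN_I[OF b]; simp)+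
  ultimately show False
    using connectedD[OF connected_UNIV, of ?U ?V] by blast
qed

definition translation_symmetries :: "'a :: ab_group_add set \<Rightarrow> 'a set" where
  "translation_symmetries X = {t. (+) t ` X = X}"

lemma translation_symmetries_iff:
  "t \<in> translation_symmetries X \<longleftrightarrow> (\<forall>x. t + x \<in> X \<longleftrightarrow> x \<in> X)"
proof -
  have "(+) t ` X = X \<longleftrightarrow> (\<forall>x. t + x \<in> X \<longleftrightarrow> x \<in> X)"
  proof
    assume "(+) t ` X = X"
    then show "\<forall>x. t + x \<in> X \<longleftrightarrow> x \<in> X"
      by (metis add_left_cancel imageE imageI)
  next
    assume h: "\<forall>x. t + x \<in> X \<longleftrightarrow> x \<in> X"
    have "x \<in> (+) t ` X" if "x \<in> X" for x
      by (rule image_eqI[of _ _ "x - t"]) (use that h[rule_format, of "x - t"] in auto)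
    then show "(+) t ` X = X" using h by auto
  qed
  then show ?thesis by (simp add: translation_symmetries_def)
qed

text \<open>The points \<open>z\<close> whose \<open>s\<close>-patch looks like that of \<open>z + (y - x)\<close> include \<open>x\<close> and are closed under
  steps shorter than \<open>2 r\<close>, because the \<open>s\<close>-patch of the next point lies in the known
  \<open>(s + 2 r)\<close>-patch of the present one. So they are all of \<open>X\<close>. This only shows that \<open>y - x\<close> maps
  \<open>X\<close> into itself; exchanging \<open>x\<close> and \<open>y\<close> gives the inverse.\<close>

lemma patch_equiv_imp_translation_symmetry:
  fixes X :: "(real ^ 'n) set"
  assumes cover: "(\<Union>x\<in>X. ball x r) = UNIV" and "s > 0"
    and stab: "patch_equiv X s = patch_equiv X (s + 2 * r)"
    and xy: "(x, y) \<in> patch_equiv X s"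
  shows "y - x \<in> translation_symmetries X"
proof -
  have *: "z + (y - x) \<in> X" if xy: "(x, y) \<in> patch_equiv X s" and "z \<in> X" for x y z
  proof -
    let ?C = "{z \<in> X. (z, z + (y - x)) \<in> patch_equiv X s}"
    have "?C = X"
    proof (rule covered_set_chain_connected[OF cover])
      have "x \<in> ?C" using xy by (auto simp: patch_equiv_iff)
      then show "?C \<noteq> {}" by blast
      fix a b assume a: "a \<in> ?C" and b: "b \<in> X" and d: "dist a b < 2 * r"
      have eq: "a + v \<in> X \<longleftrightarrow> a + (y - x) + v \<in> X" if "norm v < s + 2 * r" for v
        using a that unfolding stab by (auto simp: patch_equiv_iff)
      have shift: "b + w \<in> X \<longleftrightarrow> b + (y - x) + w \<in> X" if "norm w < s" for w
      proof -
        have "norm ((b - a) + w) < s + 2 * r"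
          using norm_triangle_ineq[of "b - a" w] that d by (simp add: dist_norm norm_minus_commute)
        from eq[OF this] show ?thesis by (simp add: algebra_simps)
      qed
      \<comment> \<open>The displacement \<open>0\<close> shows that \<open>b + (y - x)\<close> is itself a point of \<open>X\<close>.\<close>
      show "b \<in> ?C"
        using shift[of 0] \<open>s > 0\<close> shift b by (auto simp: patch_equiv_iff)
    qed auto
    then show ?thesis using \<open>z \<in> X\<close> by (auto simp: patch_equiv_iff)
  qed
  have yx: "(y, x) \<in> patch_equiv X s" using xy by (auto simp: patch_equiv_iff)
  show ?thesis
    unfolding translation_symmetries_iff
  proof (intro allI iffI)
    fix z assume "y - x + z \<in> X"
    from *[OF yx this] show "z \<in> X" by simp
  next
    fix z assume "z \<in> X"
    from *[OF xy this] show "y - x + z \<in> X" by (simp add: add.commute)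
  qed
qed

section \<open>A spanning set of symmetries gives a crystal\<close>

text \<open>A vector \<open>v\<close> orthogonal to all symmetries takes only the finitely many values \<open>v \<bullet> f\<close> on \<open>X\<close>,
  whereas a relatively dense set is unbounded in every direction.\<close>

lemma translation_symmetries_span:
  fixes X :: "'a :: euclidean_space set"
  assumes cover: "(\<Union>x\<in>X. ball x r) = UNIV" and "finite F"
    and dec: "\<And>x. x \<in> X \<Longrightarrow> \<exists>f\<in>F. x - f \<in> translation_symmetries X"
  shows "span (translation_symmetries X) = UNIV"
proof (rule ccontr)
  assume "span (translation_symmetries X) \<noteq> UNIV"
  then obtain v where "v \<noteq> 0" and v: "\<And>t. t \<in> span (translation_symmetries X) \<Longrightarrow> v \<bullet> t = 0"
    using span_not_univ_subset_hyperplane[of "translation_symmetries X"] by blast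
  have "finite ((\<lambda>f. v \<bullet> f) ` F)" using \<open>finite F\<close> by simp
  then obtain m where m: "\<And>f. f \<in> F \<Longrightarrow> v \<bullet> f \<le> m"
    by (metis bdd_above_finite bdd_above.unfold imageI)
  have le: "v \<bullet> x \<le> m" if x: "x \<in> X" for x
  proof -
    obtain f where f: "f \<in> F" "x - f \<in> translation_symmetries X" using dec[OF x] by blast
    then have "v \<bullet> (x - f) = 0" using v span_base by blast
    then show ?thesis using m[OF f(1)] by (simp add: inner_diff_right)
  qed
  \<comment> \<open>A point so far in the direction of \<open>v\<close> that every point within \<open>r\<close> of it exceeds \<open>m\<close>.\<close>
  define p where "p = ((m + norm v * r) / (v \<bullet> v)) *\<^sub>R v"
  have vp: "v \<bullet> p = m + norm v * r" using \<open>v \<noteq> 0\<close> by (simp add: p_def)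
  obtain x where x: "x \<in> X" "dist x p < r" using cover UNIV_I[of p] by (force simp flip: cover)
  have "v \<bullet> (p - x) \<le> norm v * norm (p - x)" by (rule norm_cauchy_schwarz)
  also have "\<dots> < norm v * r" using x \<open>v \<noteq> 0\<close> by (simp add: dist_norm norm_minus_commute)
  finally show False using le[OF x(1)] vp by (simp add: inner_diff_right)
qed

lemma translation_symmetries_scale_int:
  fixes X :: "'a :: real_vector set"
  assumes t: "t \<in> translation_symmetries X"
  shows "of_int k *\<^sub>R t \<in> translation_symmetries X"
proof (induction k rule: int_induct[where k = 0])
  case base
  then show ?case by (simp add: translation_symmetries_iff)
next
  case (step1 i)
  have "of_int (i + 1) *\<^sub>R t + x = of_int i *\<^sub>R t + (t + x)" for x
    by (simp add: scaleR_left_distrib add.assoc)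
  then show ?case using step1 t unfolding translation_symmetries_iff by presburger
next
  case (step2 i)
  have "of_int i *\<^sub>R t + x = t + (of_int (i - 1) *\<^sub>R t + x)" for x
    by (simp add: scaleR_left_diff_distrib)
  then show ?case using step2 t unfolding translation_symmetries_iff by metis
qed

lemma translation_symmetries_sum:
  assumes "\<And>b. b \<in> B \<Longrightarrow> g b \<in> translation_symmetries X"
  shows "(\<Sum>b\<in>B. g b) \<in> translation_symmetries X"
  using assms
  by (induction B rule: infinite_finite_induct) (auto simp: translation_symmetries_iff add.assoc)

lemma packing_radius_separated:
  assumes "packing_radius X > 0"
  obtains e where "e > 0" "\<And>x y. x \<in> X \<Longrightarrow> y \<in> X \<Longrightarrow> dist x y < e \<Longrightarrow> x = y"
proof -
  let ?D = "{ereal (dist x y) | x y. x \<in> X \<and> y \<in> X \<and> x \<noteq> y}"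
  have "0 < Inf ?D"
  proof (rule ccontr)
    assume "\<not> 0 < Inf ?D"
    then have "Inf ?D / 2 \<le> 0" by (simp add: ereal_divide_le_pos)
    then show False using assms by (simp add: packing_radius_def)
  qed
  then obtain e where e: "0 < e" "ereal e < Inf ?D"
    using ereal_dense2[of 0 "Inf ?D"] by (auto simp flip: ereal_less(2))
  have "x = y" if "x \<in> X" "y \<in> X" "dist x y < e" for x y
  proof (rule ccontr)
    assume "x \<noteq> y"
    then have "Inf ?D \<le> ereal (dist x y)" using that by (intro Inf_lower) blast
    also have "\<dots> < ereal e" using that by simp
    finally show False using e by simp
  qed
  then show thesis using e that by blast
qed

lemma covering_radius_less_imp_cover:
  assumes "covering_radius X < ereal r"
  shows "(\<Union>x\<in>X. ball x r) = UNIV"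
proof -
  obtain q where "q < r" and q: "(\<Union>x\<in>X. cball x q) = UNIV"
    using assms unfolding covering_radius_def Inf_less_iff by auto
  have "cball x q \<subseteq> ball x r" for x :: "real ^ 'n" using \<open>q < r\<close> by auto
  then have "(\<Union>x\<in>X. cball x q) \<subseteq> (\<Union>x\<in>X. ball x r)" by (rule UN_mono[OF subset_refl])
  then show ?thesis using q by auto
qed

text \<open>Rounding down the coordinates of a point of \<open>X\<close> in a basis \<open>B\<close> of symmetries subtracts a lattice
  vector, itself a symmetry, and leaves a point of \<open>X\<close> in the fundamental parallelepiped of \<open>B\<close>. That
  region is bounded, and a uniformly discrete set has only finitely many points in it.\<close>

lemma ideal_crystal_if_symmetries_span:
  fixes X :: "(real ^ 'n) set"
  assumes X: "delone_set X" and span: "span (translation_symmetries X) = UNIV"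
  shows "ideal_crystal X"
proof -
  obtain B where B: "B \<subseteq> translation_symmetries X" "independent B" "UNIV \<subseteq> span B"
    using basis_exists[of "translation_symmetries X"] span
    by (metis span_mono span_span)
  have finB: "finite B" using B(2) by (rule independent_imp_finite)
  define L where "L = {\<Sum>b\<in>B. of_int (c b) *\<^sub>R b | c :: real ^ 'n \<Rightarrow> int. True}"
  have "full_rank_lattice L"
    using B unfolding full_rank_lattice_def L_def by blast
  have L: "t \<in> translation_symmetries X" if "t \<in> L" for t
    using that B(1) unfolding L_def
    by (auto intro!: translation_symmetries_sum translation_symmetries_scale_int)
  \<comment> \<open>The ball contains the fundamental parallelepiped of \<open>B\<close>.\<close>
  define F where "F = X \<inter> cball 0 (\<Sum>b\<in>B. norm b)"
  obtain e where e: "e > 0" "\<And>x y. x \<in> X \<Longrightarrow> y \<in> X \<Longrightarrow> dist x y < e \<Longrightarrow> x = y"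
    using X packing_radius_separated unfolding delone_set_def by blast
  have "finite F"
  proof (rule ccontr)
    assume "infinite F"
    then obtain l where "l islimpt F"
      using Heine_Borel_imp_Bolzano_Weierstrass[OF compact_cball] unfolding F_def by blast
    moreover have "\<not> l islimpt F"
    proof (rule discrete_imp_not_islimpt[OF e(1)])
      fix x y assume "x \<in> F" "y \<in> F" "dist y x < e"
      then show "y = x" by (intro e(2)) (auto simp: F_def)
    qed
    ultimately show False by blast
  qed
  have "x \<in> L + F" if x: "x \<in> X" for x
  proof -
    have "x \<in> span B" using B by blast
    then obtain u where u: "x = (\<Sum>b\<in>B. u b *\<^sub>R b)"
      unfolding span_finite[OF finB] by blast
    define l where "l = (\<Sum>b\<in>B. of_int \<lfloor>u b\<rfloor> *\<^sub>R b)"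
    have "l \<in> L" unfolding L_def l_def by (intro CollectI exI[of _ "\<lambda>b. \<lfloor>u b\<rfloor>"]) simp
    have "x - l = (\<Sum>b\<in>B. frac (u b) *\<^sub>R b)"
      by (simp add: u l_def frac_def scaleR_diff_left sum_subtractf)
    also have "norm \<dots> \<le> (\<Sum>b\<in>B. norm b)"
      by (intro sum_norm_le) (simp add: mult_left_le_one_le frac_ge_0 less_imp_le[OF frac_lt_1])
    finally have "x - l \<in> cball 0 (\<Sum>b\<in>B. norm b)" by simp
    moreover have "x - l \<in> X"
      using L[OF \<open>l \<in> L\<close>] x unfolding translation_symmetries_iff by (metis add_diff_cancel_left' diff_add_cancel add.commute)
    ultimately have "x - l \<in> F" by (simp add: F_def)
    then show ?thesis using set_plus_intro[OF \<open>l \<in> L\<close>] by fastforce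
  qed
  moreover have "L + F \<subseteq> X"
    using L by (auto simp: F_def translation_symmetries_iff elim!: set_plus_elim)
  ultimately have "X = L + F" by blast
  then show ?thesis
    using X \<open>full_rank_lattice L\<close> \<open>finite F\<close> unfolding ideal_crystal_def by blast
qed

section \<open>Few patches force crystallinity\<close>

theorem theorem2p1:
  fixes X :: "(real ^ 'n) set" and R T :: real
  assumes "delone_set X"
    and "covering_radius X = ereal R"
    and "T > 0"
    and "ereal_of_enat (patch_count X T) < ereal (T / (2 * R))"
  shows "ideal_crystal X"
proof -
  define N where "N = card (X // patch_equiv X T)"
  have fin: "finite (X // patch_equiv X T)"
  proof (rule ccontr)
    assume "infinite (X // patch_equiv X T)"
    then show False using assms(4) by (simp add: patch_count_def)
  qed
  have N: "real N < T / (2 * R)"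
    using assms(4) fin by (simp add: patch_count_def N_def)
  have "R > 0"
  proof -
    have "0 < T / (2 * R)" using N of_nat_0_le_iff[of N] by (rule le_less_trans[rotated])
    then show ?thesis using \<open>T > 0\<close> by (simp add: zero_less_divide_iff)
  qed
  have "X \<noteq> {}"
    using covering_radius_less_imp_cover[of X "R + 1"] assms(2) by auto
  then have "N > 0" using fin unfolding N_def by (auto simp: card_gt_0_iff quotient_def)
  then have "R < T / (2 * N)" using N \<open>R > 0\<close> by (simp add: field_simps)
  \<comment> \<open>A radius strictly above \<open>R\<close>, so that already the open balls of radius \<open>r\<close> cover the space.\<close>
  then obtain r where r: "R < r" "r < T / (2 * N)" using dense by blast
  have "r > 0" using r \<open>R > 0\<close> by simp
  have cover: "(\<Union>x\<in>X. ball x r) = UNIV"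
    by (rule covering_radius_less_imp_cover) (simp add: assms(2) r)
  have "2 * r * N < T" using r \<open>N > 0\<close> by (simp add: field_simps)
  then obtain s where s: "s > 0" "finite (X // patch_equiv X s)"
      "patch_equiv X s = patch_equiv X (s + 2 * r)"
    using patch_equiv_stabilizes[OF \<open>X \<noteq> {}\<close> \<open>r > 0\<close> fin, of N] unfolding N_def by blast
  \<comment> \<open>One representative of each class of \<open>s\<close>-patches.\<close>
  define F where "F = (\<lambda>C. SOME f. f \<in> C) ` (X // patch_equiv X s)"
  have "\<exists>f\<in>F. x - f \<in> translation_symmetries X" if x: "x \<in> X" for x
  proof -
    let ?C = "patch_equiv X s `` {x}"
    have "x \<in> ?C" by (rule equiv_class_self[OF equiv_patch_equiv x])
    then have "(SOME f. f \<in> ?C) \<in> ?C" by (rule someI)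
    then have "((SOME f. f \<in> ?C), x) \<in> patch_equiv X s" by (auto simp: patch_equiv_iff)
    from patch_equiv_imp_translation_symmetry[OF cover s(1,3) this] show ?thesis
      using x unfolding F_def by (blast intro: quotientI)
  qed
  moreover have "finite F" using s(2) by (simp add: F_def)
  ultimately have "span (translation_symmetries X) = UNIV"
    using translation_symmetries_span[OF cover] by blast
  then show ?thesis using ideal_crystal_if_symmetries_span assms(1) by blast
qed

end
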